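(* Let $R$ be an order in an $S_3$-cubic field. The map $\varphi:\mathcal I_2(R)\to H(R)$, $I\mapsto$ the class of $(R,I,1)$, is an injective group homomorphism whose image is exactly $H_{\rm red}(R)$; hence $\mathcal I_2(R)\cong H_{\rm red}(R)$.
   Context: An $S_3$-cubic field is a cubic field whose Galois closure has Galois group $S_3$. $\mathcal I_2(R)$ is the group of invertible fractional ideals $I$ of $R$ with $I^2=R$. For $K=R\otimes\mathbb Q$, a projective triple is $(R,I,\delta)$ with $I$ an invertible fractional ideal, $\delta\in K^\times$, $I^2=(\delta)$ and $N(\delta)=N(I)^2$; triples are equivalent if $I'=\kappa I$, $\delta'=\kappa^2\delta$ for some $\kappa\in K^\times$; $H(R)$ is the group of equivalence classes under $(R,I,\delta)\circ(R,I',\delta')=(R,II',\delta\delta')$. $H_{\rm red}(R)$ is the subgroup of classes of triples $(R,I,\delta)$ with $\delta$ a square in $K^\times$. *)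

theory Defs
  imports
    "HOL-Analysis.Determinants"
    "HOL-Algebra.Algebraic_Closure_Type"
    "HOL-Algebra.Sym_Groups"
    "HOL-Algebra.Bij"
begin

text \<open>
  The cubic field is the whole type \<open>'a :: field_char_0\<close>, of dimension 3 over the rationals;
  ideals and orders are subsets of it.  The groups are HOL-Algebra monoid records.
\<close>

global_interpretation rat_vs: vector_space "\<lambda>(q::rat) (x::'a::field_char_0). of_rat q * x"
  by unfold_locales (simp_all add: algebra_simps of_rat_add of_rat_mult)

global_interpretation int_mod: Modules.module "\<lambda>(n::int) (x::'a::comm_ring_1). of_int n * x"
  by unfold_locales (simp_all add: algebra_simps)


section \<open>Cubic fields with Galois group of type S3\<close>

definition normal_over_rat :: "'b::field_char_0 alg_closure set \<Rightarrow> bool" where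
  "normal_over_rat F \<longleftrightarrow>
     (\<forall>p::rat poly. Factorial_Ring.irreducible p \<longrightarrow> (\<exists>x\<in>F. poly (map_poly of_rat p) x = 0) \<longrightarrow>
        (\<forall>x. poly (map_poly of_rat p) x = 0 \<longrightarrow> x \<in> F))"

text \<open>
  The smallest subfield of the algebraic closure of \<open>'a\<close> that contains \<open>'a\<close> and is normal over
  the rationals (separability is automatic in characteristic 0, and everything is algebraic over
  the rationals when \<open>'a\<close> is).
\<close>

definition galois_closure :: "'a::field_char_0 alg_closure set" where
  "galois_closure =
     \<Inter> {F. subfield F ring_of_type_algebra \<and> range (to_ac :: 'a \<Rightarrow> _) \<subseteq> F \<and> normal_over_rat F}"

definition rat_galois_group :: "'b::field_char_0 set \<Rightarrow> ('b \<Rightarrow> 'b) monoid" where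
  "rat_galois_group L = (BijGroup L)
     \<lparr>carrier := {\<sigma> \<in> Bij L.
        \<sigma> \<in> ring_hom (ring_of_type_algebra\<lparr>carrier := L\<rparr>) (ring_of_type_algebra\<lparr>carrier := L\<rparr>) \<and>
        (\<forall>q::rat. \<sigma> (of_rat q) = of_rat q)}\<rparr>"

definition S3_cubic_field :: "'a::field_char_0 itself \<Rightarrow> bool" where
  "S3_cubic_field _ \<longleftrightarrow>
     rat_vs.dim (UNIV :: 'a set) = 3 \<and>
     rat_galois_group (galois_closure :: 'a alg_closure set) \<cong> sym_group 3"

text \<open>
  The norm of a cubic field down to the rationals: the determinant of multiplication by \<open>x\<close>
  with respect to a rational basis.
\<close>

definition cubic_norm :: "'a::field_char_0 \<Rightarrow> rat" where
  "cubic_norm x =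
     (let b = (SOME b :: 3 \<Rightarrow> 'a.
                 inj b \<and> rat_vs.independent (range b) \<and> rat_vs.span (range b) = UNIV)
      in det (\<chi> i j. rat_vs.representation (range b) (x * b j) (b i)))"


section \<open>Orders and fractional ideals\<close>

definition is_order :: "'a::field_char_0 set \<Rightarrow> bool" where
  "is_order R \<longleftrightarrow>
     subring R ring_of_type_algebra \<and>
     (\<exists>B. finite B \<and> R = int_mod.span B) \<and>
     rat_vs.span R = UNIV"

definition fractional_ideal :: "'a::field_char_0 set \<Rightarrow> 'a set \<Rightarrow> bool" where
  "fractional_ideal R I \<longleftrightarrow>
     0 \<in> I \<and> (\<forall>x\<in>I. \<forall>y\<in>I. x + y \<in> I) \<and> (\<forall>r\<in>R. \<forall>x\<in>I. r * x \<in> I) \<and>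
     (\<exists>d\<in>R. d \<noteq> 0 \<and> (\<forall>x\<in>I. d * x \<in> R))"

definition ideal_mult :: "'a::field_char_0 set \<Rightarrow> 'a set \<Rightarrow> 'a set" where
  "ideal_mult I J = int_mod.span {x * y | x y. x \<in> I \<and> y \<in> J}"

definition scale_ideal :: "'a::field_char_0 \<Rightarrow> 'a set \<Rightarrow> 'a set" where
  "scale_ideal k I = (\<lambda>x. k * x) ` I"

definition invertible_ideal :: "'a::field_char_0 set \<Rightarrow> 'a set \<Rightarrow> bool" where
  "invertible_ideal R I \<longleftrightarrow>
     fractional_ideal R I \<and> (\<exists>J. fractional_ideal R J \<and> ideal_mult I J = R)"

definition subgroup_index :: "'a::ab_group_add set \<Rightarrow> 'a set \<Rightarrow> nat" where
  "subgroup_index A B = card ((\<lambda>a. (\<lambda>b. a + b) ` B) ` A)"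

text \<open>
  For \<open>I \<subseteq> R\<close> this is the usual index of \<open>I\<close> in \<open>R\<close>; in general \<open>I\<close> and \<open>R\<close> are only commensurable.
\<close>

definition ideal_norm :: "'a::field_char_0 set \<Rightarrow> 'a set \<Rightarrow> rat" where
  "ideal_norm R I = of_nat (subgroup_index R (R \<inter> I)) / of_nat (subgroup_index I (R \<inter> I))"

definition I2_group :: "'a::field_char_0 set \<Rightarrow> 'a set monoid" where
  "I2_group R =
     \<lparr>carrier = {I. invertible_ideal R I \<and> ideal_mult I I = R}, mult = ideal_mult, one = R\<rparr>"


section \<open>Projective triples\<close>

text \<open>The order \<open>R\<close> is fixed, so a triple \<open>(R, I, \<delta>)\<close> is represented by the pair \<open>(I, \<delta>)\<close>.\<close>

definition projective_triples :: "'a::field_char_0 set \<Rightarrow> ('a set \<times> 'a) set" where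
  "projective_triples R =
     {(I, \<delta>). invertible_ideal R I \<and> \<delta> \<noteq> 0 \<and>
        ideal_mult I I = scale_ideal \<delta> R \<and> cubic_norm \<delta> = (ideal_norm R I)\<^sup>2}"

definition triple_rel :: "'a::field_char_0 set \<Rightarrow> (('a set \<times> 'a) \<times> ('a set \<times> 'a)) set" where
  "triple_rel R =
     {((I, \<delta>), (I', \<delta>')). (I, \<delta>) \<in> projective_triples R \<and> (I', \<delta>') \<in> projective_triples R \<and>
        (\<exists>\<kappa>. \<kappa> \<noteq> 0 \<and> I' = scale_ideal \<kappa> I \<and> \<delta>' = \<kappa>\<^sup>2 * \<delta>)}"

definition triple_class :: "'a::field_char_0 set \<Rightarrow> 'a set \<times> 'a \<Rightarrow> ('a set \<times> 'a) set" where
  "triple_class R t = triple_rel R `` {t}"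

definition triple_mult :: "'a::field_char_0 set \<times> 'a \<Rightarrow> 'a set \<times> 'a \<Rightarrow> 'a set \<times> 'a" where
  "triple_mult = (\<lambda>(I, \<delta>) (I', \<delta>'). (ideal_mult I I', \<delta> * \<delta>'))"

definition H_group :: "'a::field_char_0 set \<Rightarrow> ('a set \<times> 'a) set monoid" where
  "H_group R =
     \<lparr>carrier = projective_triples R // triple_rel R,
      mult = (\<lambda>C D. \<Union>s\<in>C. \<Union>t\<in>D. triple_class R (triple_mult s t)),
      one = triple_class R (R, 1)\<rparr>"

definition H_red :: "'a::field_char_0 set \<Rightarrow> ('a set \<times> 'a) set set" where
  "H_red R =
     {triple_class R (I, \<delta>) | I \<delta>. (I, \<delta>) \<in> projective_triples R \<and> (\<exists>\<kappa>. \<kappa> \<noteq> 0 \<and> \<delta> = \<kappa>\<^sup>2)}"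

definition I2_to_H :: "'a::field_char_0 set \<Rightarrow> 'a set \<Rightarrow> ('a set \<times> 'a) set" where
  "I2_to_H R I = triple_class R (I, 1)"

end

theory Submission
  imports Defs
begin

text \<open>
  Everything rests on the multiplicativity of the norm on invertible ideals of \<open>R\<close>, which makes
  \<open>H(R)\<close> closed under composition.  If \<open>I\<close> is invertible, then \<open>A \<mapsto> I A\<close> is an automorphism of the
  lattice of \<open>R\<close>-modules that preserves the annihilators of simple quotients, hence also
  their cardinalities, so \<open>[B : A] = [I B : I A]\<close>.  Consequently \<open>I\<^sup>2 = R\<close> forces \<open>N(I) = 1\<close>.
  Every class of \<open>H(R)\<close> is its own inverse, as \<open>(I\<^sup>2, \<delta>\<^sup>2) = \<delta> \<cdot> (R, 1)\<close>.  A triple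
  \<open>(I, \<kappa>\<^sup>2)\<close> is equivalent to \<open>(\<kappa>\<^sup>-\<^sup>1 I, 1)\<close>, which gives the image; and \<open>(I, 1) \<sim> (J, 1)\<close> forces
  \<open>\<kappa> = \<plusminus>1\<close>, so \<open>I = J\<close>.
\<close>

section \<open>Indices of additive subgroups\<close>

text \<open>Picking a preimage under \<open>h\<close> and applying \<open>k\<close> is a bijection
  between the images, so sets of cosets can be counted through another labelling. Infinite images
  are covered, both cardinalities then being 0.\<close>

lemma card_image_eq_if_same_fibres:
  assumes "\<And>x y. x \<in> A \<Longrightarrow> y \<in> A \<Longrightarrow> h x = h y \<longleftrightarrow> k x = k y"
  shows "card (h ` A) = card (k ` A)"
proof -
  have "bij_betw (\<lambda>z. k (inv_into A h z)) (h ` A) (k ` A)"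
  proof (rule bij_betw_imageI)
    show "inj_on (\<lambda>z. k (inv_into A h z)) (h ` A)"
      by (rule inj_onI) (metis assms f_inv_into_f inv_into_into)
    have "k (inv_into A h (h x)) = k x" if "x \<in> A" for x
      using that by (metis assms f_inv_into_f imageI inv_into_into)
    then show "(\<lambda>z. k (inv_into A h z)) ` h ` A = k ` A"
      by (force simp: image_image)
  qed
  then show ?thesis by (rule bij_betw_same_card)
qed

lemma coset_eq_iff:
  assumes "int_mod.subspace (B :: 'a::comm_ring_1 set)"
  shows "(\<lambda>b. a + b) ` B = (\<lambda>b. a' + b) ` B \<longleftrightarrow> a - a' \<in> B"
proof
  assume "(\<lambda>b. a + b) ` B = (\<lambda>b. a' + b) ` B"
  moreover have "a + 0 \<in> (\<lambda>b. a + b) ` B"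
    using int_mod.subspace_0[OF assms] by blast
  ultimately show "a - a' \<in> B" by auto
next
  assume d: "a - a' \<in> B"
  have "a + b = a' + ((a - a') + b)" "a' + b = a + (b - (a - a'))" for b by simp_all
  with d int_mod.subspace_add[OF assms d] int_mod.subspace_diff[OF assms _ d]
  show "(\<lambda>b. a + b) ` B = (\<lambda>b. a' + b) ` B"
    unfolding image_def by blast
qed

text \<open>\<open>f\<close> induces a bijection from the cosets of \<open>B\<close> in
  \<open>A\<close> to those of \<open>B'\<close> in \<open>A'\<close>: \<open>ker\<close> gives
  injectivity, and \<open>surj\<close> asks for preimages only modulo \<open>B'\<close>.\<close>

lemma subgroup_index_eq_if_hom:
  fixes f :: "'a::field_char_0 \<Rightarrow> 'a"
  assumes A: "int_mod.subspace A" and B: "int_mod.subspace B" and B': "int_mod.subspace B'"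
    and f: "\<And>x y. f (x - y) = f x - f y"
    and "\<And>x. x \<in> A \<Longrightarrow> f x \<in> A'"
    and surj: "\<And>y. y \<in> A' \<Longrightarrow> \<exists>x\<in>A. y - f x \<in> B'"
    and ker: "\<And>x. x \<in> A \<Longrightarrow> f x \<in> B' \<longleftrightarrow> x \<in> B"
  shows "subgroup_index A B = subgroup_index A' B'"
proof -
  have "(\<lambda>a. (\<lambda>b. a + b) ` B') ` A' = (\<lambda>a. (\<lambda>b. f a + b) ` B') ` A"
    using assms(5) surj coset_eq_iff[OF B'] unfolding image_def by fastforce
  moreover have "card ((\<lambda>a. (\<lambda>b. a + b) ` B) ` A) = card ((\<lambda>a. (\<lambda>b. f a + b) ` B') ` A)"
    by (rule card_image_eq_if_same_fibres)
      (simp add: coset_eq_iff[OF B'] coset_eq_iff[OF B] f[symmetric] ker int_mod.subspace_diff[OF A]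
        del: add_diff_cancel)
  ultimately show ?thesis by (simp add: subgroup_index_def)
qed

text \<open>With a representative \<open>c a\<close> fixed in each coset of \<open>B\<close>, the
  coset of \<open>a\<close> modulo \<open>C\<close> amounts to the pair of its coset modulo
  \<open>B\<close> and the coset of \<open>a - c a\<close> modulo \<open>C\<close>. The formula also
  holds for infinite indices, which count as 0.\<close>

lemma subgroup_index_tower:
  fixes A :: "'a::field_char_0 set"
  assumes A: "int_mod.subspace A" and B: "int_mod.subspace B" and C: "int_mod.subspace C"
    and "C \<subseteq> B" "B \<subseteq> A"
  shows "subgroup_index A C = subgroup_index A B * subgroup_index B C"
proof -
  define q where "q a = (\<lambda>b. a + b) ` B" for a
  define c where "c a = inv_into A q (q a)" for a
  define r where "r a = (\<lambda>b. a + b) ` C" for a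
  have q: "q x = q y \<longleftrightarrow> x - y \<in> B" for x y
    unfolding q_def by (rule coset_eq_iff[OF B])
  have r: "r x = r y \<longleftrightarrow> x - y \<in> C" for x y
    unfolding r_def by (rule coset_eq_iff[OF C])
  have c: "c a \<in> A" "q (c a) = q a" if "a \<in> A" for a
    using that unfolding c_def by (simp_all add: inv_into_into f_inv_into_f)
  have c_cong: "q x = q y \<Longrightarrow> c x = c y" for x y
    by (simp add: c_def)
  have "card (r ` A) = card ((\<lambda>a. (q a, r (a - c a))) ` A)"
  proof (rule card_image_eq_if_same_fibres)
    fix x y assume "x \<in> A" "y \<in> A"
    show "r x = r y \<longleftrightarrow> (q x, r (x - c x)) = (q y, r (y - c y))"
      using c_cong[of x y] \<open>C \<subseteq> B\<close> by (auto simp: r q)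
  qed
  also have "(\<lambda>a. (q a, r (a - c a))) ` A = (q ` A) \<times> (r ` B)"
  proof (intro equalityI subsetI)
    fix z assume "z \<in> (\<lambda>a. (q a, r (a - c a))) ` A"
    then obtain a where a: "a \<in> A" "z = (q a, r (a - c a))" by blast
    have "a - c a \<in> B" using c(2)[OF a(1)] q by metis
    with a show "z \<in> (q ` A) \<times> (r ` B)" by blast
  next
    fix z assume "z \<in> (q ` A) \<times> (r ` B)"
    then obtain a b where a: "a \<in> A" "b \<in> B" "z = (q a, r b)" by blast
    \<comment> \<open>Shifting the representative \<open>c a\<close>, rather than \<open>a\<close>,
      by \<open>b\<close> makes the second component exactly \<open>r b\<close>, because
      \<open>c x = c a\<close>.\<close>
    define x where "x = c a + b"
    have x: "x \<in> A"
      using a c \<open>B \<subseteq> A\<close> int_mod.subspace_add[OF A] by (auto simp: x_def)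
    have "q x = q (c a)" using a by (simp add: q x_def)
    then have qx: "q x = q a" using c a by simp
    then have "c x = c a" by (rule c_cong)
    then have "z = (q x, r (x - c x))" using a qx by (simp add: x_def)
    with x show "z \<in> (\<lambda>a. (q a, r (a - c a))) ` A" by blast
  qed
  finally show ?thesis
    by (simp add: card_cartesian_product subgroup_index_def q_def r_def)
qed

lemma subgroup_index_self:
  assumes "int_mod.subspace (A :: 'a::field_char_0 set)"
  shows "subgroup_index A A = 1"
proof -
  have "(\<lambda>b. a + b) ` A = A" if "a \<in> A" for a
    using coset_eq_iff[OF assms, of a 0] that by simp
  then have "(\<lambda>a. (\<lambda>b. a + b) ` A) ` A = {A}"
    using int_mod.subspace_0[OF assms] by auto
  then show ?thesis by (simp add: subgroup_index_def)
qed

text \<open>The only coset is that of 0, namely \<open>B\<close>. In contrapositive form this makes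
  both factors of a tower of proper inclusions different from 1.\<close>

lemma subgroup_index_eq_1_imp_subset:
  assumes A: "int_mod.subspace (A :: 'a::field_char_0 set)" and B: "int_mod.subspace B"
    and "subgroup_index A B = 1"
  shows "A \<subseteq> B"
proof
  fix x assume "x \<in> A"
  obtain z where z: "(\<lambda>a. (\<lambda>b. a + b) ` B) ` A = {z}"
    using assms(3) unfolding subgroup_index_def by (rule card_1_singletonE)
  have eq: "(\<lambda>b. a + b) ` B = z" if "a \<in> A" for a
  proof -
    have "(\<lambda>b. a + b) ` B \<in> (\<lambda>a. (\<lambda>b. a + b) ` B) ` A" using that by (rule imageI)
    then show ?thesis unfolding z by simp
  qed
  have "(\<lambda>b. x + b) ` B = (\<lambda>b. 0 + b) ` B"
    unfolding eq[OF \<open>x \<in> A\<close>] eq[OF int_mod.subspace_0[OF A]] ..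
  then show "x \<in> B" using coset_eq_iff[OF B, of x 0] by simp
qed

text \<open>Since \<open>card\<close> of an infinite set is 0, a nonzero index means a finite one.
  Reducing integer coefficients modulo \<open>n\<close> leaves finitely many coset
  representatives.\<close>

lemma subgroup_index_scale_int_nonzero:
  fixes B :: "'a::field_char_0 set" and n :: int
  assumes "finite B" "n > 0"
  shows "subgroup_index (int_mod.span B) (scale_ideal (of_int n) (int_mod.span B)) \<noteq> 0"
proof -
  let ?M = "int_mod.span B"
  let ?N = "scale_ideal (of_int n) ?M"
  let ?s = "\<lambda>u :: 'a \<Rightarrow> int. \<Sum>v\<in>B. of_int (u v) * v"
  have N: "int_mod.subspace ?N"
    unfolding scale_ideal_def
    by (rule int_mod.subspaceI)
      (auto simp: image_iff int_mod.span_zero simp flip: distrib_left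
        intro: int_mod.span_add, metis int_mod.span_scale)
  let ?U = "B \<rightarrow>\<^sub>E {0..<n}"
  have "(\<lambda>b. x + b) ` ?N \<in> (\<lambda>u. (\<lambda>b. ?s u + b) ` ?N) ` ?U" if x: "x \<in> ?M" for x
  proof -
    obtain u where u: "x = ?s u"
      using x int_mod.span_finite[OF \<open>finite B\<close>] by auto
    \<comment> \<open>\<open>restrict\<close> puts the reduced coefficients into the extensional
      function space \<open>?U\<close>, which is finite.\<close>
    define w where "w = restrict (\<lambda>v. u v mod n) B"
    have w: "w \<in> ?U" using \<open>n > 0\<close> by (auto simp: w_def)
    have "x - ?s w = (\<Sum>v\<in>B. of_int (u v - w v) * v)"
      by (simp add: u sum_subtractf algebra_simps)
    also have "\<dots> = (\<Sum>v\<in>B. of_int n * (of_int (u v div n) * v))"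
    proof (rule sum.cong)
      fix v assume "v \<in> B"
      then have "u v - w v = n * (u v div n)" by (simp add: w_def minus_mod_eq_mult_div)
      then show "of_int (u v - w v) * v = of_int n * (of_int (u v div n) * v)"
        by (simp only: of_int_mult mult.assoc)
    qed simp
    also have "\<dots> = of_int n * ?s (\<lambda>v. u v div n)" by (simp add: sum_distrib_left)
    finally have "x - ?s w \<in> ?N"
      using int_mod.span_finite[OF \<open>finite B\<close>] by (auto simp: scale_ideal_def)
    then have "(\<lambda>b. x + b) ` ?N = (\<lambda>b. ?s w + b) ` ?N" by (rule coset_eq_iff[OF N, THEN iffD2])
    then show ?thesis using w by (rule image_eqI)
  qed
  then have "(\<lambda>a. (\<lambda>b. a + b) ` ?N) ` ?M \<subseteq> (\<lambda>u. (\<lambda>b. ?s u + b) ` ?N) ` ?U"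
    by (rule image_subsetI)
  then have "finite ((\<lambda>a. (\<lambda>b. a + b) ` ?N) ` ?M)"
    by (rule finite_subset) (simp add: finite_PiE \<open>finite B\<close>)
  then show ?thesis
    using int_mod.span_zero[of B] by (simp add: subgroup_index_def card_eq_0_iff) blast
qed


section \<open>The norm of elements\<close>

text \<open>\<open>M x\<close> is the matrix of multiplication by \<open>x\<close>; \<open>M\<close>
  is multiplicative and so is \<open>det\<close>. Dimension 3 supplies a basis indexed by the type
  \<open>3\<close>, so the choice in \<open>cubic_norm\<close> is a genuine basis.\<close>

lemma cubic_norm_mult_one:
  assumes "rat_vs.dim (UNIV :: 'a::field_char_0 set) = 3"
  shows "cubic_norm (x * y :: 'a) = cubic_norm x * cubic_norm y"
    and "cubic_norm (1 :: 'a) = 1"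
proof -
  define P where "P =
    (\<lambda>b :: 3 \<Rightarrow> 'a. inj b \<and> rat_vs.independent (range b) \<and> rat_vs.span (range b) = UNIV)"
  obtain B :: "'a set" where B: "rat_vs.independent B" "UNIV \<subseteq> rat_vs.span B" "card B = 3"
    using rat_vs.basis_exists[of UNIV] assms by metis
  have "finite B" using B(3) card.infinite by fastforce
  then obtain b :: "3 \<Rightarrow> 'a" where "bij_betw b UNIV B"
    using finite_same_card_bij[of "UNIV :: 3 set" B] B(3) by auto
  then have "P b" using B by (auto simp: P_def bij_betw_def)
  \<comment> \<open>This is the very basis chosen inside \<open>cubic_norm\<close>; \<open>b\<close>
    only witnesses that one exists.\<close>
  define c where "c = Eps P"
  have "P c" unfolding c_def using \<open>P b\<close> by (rule someI[of P])
  then have inj: "inj c" and ind: "rat_vs.independent (range c)"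
    and span: "rat_vs.span (range c) = UNIV" by (auto simp: P_def)
  define r where "r = rat_vs.representation (range c)"
  define M :: "'a \<Rightarrow> rat^3^3" where "M x = (\<chi> i j. r (x * c j) (c i))" for x
  have norm: "cubic_norm x = det (M x)" for x
    by (simp add: cubic_norm_def M_def r_def c_def P_def Let_def)
  have expand: "z = (\<Sum>k\<in>UNIV. of_rat (r z (c k)) * c k)" for z
  proof -
    have "(\<Sum>v\<in>range c. of_rat (r z v) * v) = z"
      unfolding r_def by (rule rat_vs.sum_representation_eq) (auto simp: ind span)
    then show ?thesis by (simp add: sum.reindex[OF inj])
  qed
  have "M (x * y) = M x ** M y"
  proof -
    \<comment> \<open>Entry by entry, this expands \<open>y * c j\<close> in the basis and then
      multiplies by \<open>x\<close>.\<close>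
    have "r (x * y * c j) (c i) = (\<Sum>k\<in>UNIV. r (x * c k) (c i) * r (y * c j) (c k))" for i j
    proof -
      have "x * y * c j = x * (\<Sum>k\<in>UNIV. of_rat (r (y * c j) (c k)) * c k)"
        by (subst expand[symmetric]) (simp add: mult.assoc)
      also have "\<dots> = (\<Sum>k\<in>UNIV. of_rat (r (y * c j) (c k)) * (x * c k))"
        by (simp add: sum_distrib_left algebra_simps)
      finally have "r (x * y * c j) =
          (\<lambda>v. \<Sum>k\<in>UNIV. r (of_rat (r (y * c j) (c k)) * (x * c k)) v)"
        using rat_vs.representation_sum[OF ind, of UNIV
            "\<lambda>k. of_rat (r (y * c j) (c k)) * (x * c k)"] span
        unfolding r_def by auto
      moreover have "r (of_rat a * z) = (\<lambda>v. a * r z v)" for a z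
        unfolding r_def by (rule rat_vs.representation_scale[OF ind]) (simp add: span)
      ultimately show ?thesis by (simp add: mult.commute)
    qed
    then show ?thesis by (simp add: M_def matrix_matrix_mult_def vec_eq_iff)
  qed
  then show "cubic_norm (x * y) = cubic_norm x * cubic_norm y"
    by (simp add: norm det_mul)
  have "M 1 = mat 1"
    using rat_vs.representation_basis[OF ind] inj
    by (auto simp: M_def r_def mat_def vec_eq_iff inj_eq)
  then show "cubic_norm (1 :: 'a) = 1" by (simp add: norm)
qed


section \<open>Products of ideals\<close>

lemma subspace_ideal_mult: "int_mod.subspace (ideal_mult I J)"
  by (simp add: ideal_mult_def)

lemma mult_in_ideal_mult: "x \<in> I \<Longrightarrow> y \<in> J \<Longrightarrow> x * y \<in> ideal_mult I J"
  unfolding ideal_mult_def by (rule int_mod.span_base) blast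

text \<open>The universal property of the product: containment in an additive group is tested on
  generators, so finite sums of products need not be taken apart.\<close>

lemma ideal_mult_subset_iff:
  assumes "int_mod.subspace M"
  shows "ideal_mult I J \<subseteq> M \<longleftrightarrow> (\<forall>x\<in>I. \<forall>y\<in>J. x * y \<in> M)"
proof
  assume "\<forall>x\<in>I. \<forall>y\<in>J. x * y \<in> M"
  then have "{x * y | x y. x \<in> I \<and> y \<in> J} \<subseteq> M" by blast
  then show "ideal_mult I J \<subseteq> M"
    unfolding ideal_mult_def using assms by (rule int_mod.span_minimal)
qed (use mult_in_ideal_mult in blast)

lemma ideal_mult_mono: "I \<subseteq> I' \<Longrightarrow> J \<subseteq> J' \<Longrightarrow> ideal_mult I J \<subseteq> ideal_mult I' J'"
  unfolding ideal_mult_def by (rule int_mod.span_mono) blast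

lemma ideal_mult_commute: "ideal_mult I J = ideal_mult J I"
proof -
  have "{x * y | x y. x \<in> I \<and> y \<in> J} = {x * y | x y. x \<in> J \<and> y \<in> I}"
    by (metis (no_types, opaque_lifting) mult.commute)
  then show ?thesis by (simp add: ideal_mult_def)
qed

text \<open>Paired with \<open>ideal_mult_subset_iff\<close>, this reduces
  \<open>c * x \<in> M\<close> for all \<open>x\<close> in a product of ideals to generators
  \<open>x\<close>.\<close>

lemma subspace_vimage_times:
  fixes M :: "'a::field_char_0 set"
  assumes "int_mod.subspace M"
  shows "int_mod.subspace {x. c * x \<in> M}"
proof (rule int_mod.subspaceI)
  show "of_int n * x \<in> {x. c * x \<in> M}" if "x \<in> {x. c * x \<in> M}" for n x
    using int_mod.subspace_scale[OF assms, of "c * x" n] that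
    by (simp add: mult.left_commute)
qed (simp_all add: distrib_left int_mod.subspace_0[OF assms] int_mod.subspace_add[OF assms])

lemma ideal_mult_assoc: "ideal_mult (ideal_mult I J) K = ideal_mult I (ideal_mult J K)"
proof -
  have *: "ideal_mult (ideal_mult I J) K \<subseteq> ideal_mult I (ideal_mult J K)" for I J K :: "'a set"
  proof -
    let ?M = "ideal_mult I (ideal_mult J K)"
    have "ideal_mult I J \<subseteq> {x. z * x \<in> ?M}" if "z \<in> K" for z
    proof -
      have "z * (x * y) \<in> ?M" if "x \<in> I" "y \<in> J" for x y
        using mult_in_ideal_mult[OF \<open>x \<in> I\<close> mult_in_ideal_mult[OF \<open>y \<in> J\<close> \<open>z \<in> K\<close>]]
        by (simp add: mult_ac)
      then show ?thesis
        by (simp add: ideal_mult_subset_iff subspace_vimage_times subspace_ideal_mult)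
    qed
    then have "x * z \<in> ?M" if "x \<in> ideal_mult I J" "z \<in> K" for x z
      using that by (subst mult.commute) blast
    then show ?thesis
      by (simp add: ideal_mult_subset_iff subspace_ideal_mult)
  qed
  show ?thesis
    \<comment> \<open>By commutativity, the reverse inclusion is the same one with \<open>I\<close>
      and \<open>K\<close> exchanged.\<close>
    using *[of I J K] *[of K J I] by (auto simp: ideal_mult_commute)
qed

lemma subspace_scale_ideal:
  assumes "int_mod.subspace (M :: 'a::field_char_0 set)"
  shows "int_mod.subspace (scale_ideal k M)"
  unfolding scale_ideal_def
proof (rule int_mod.subspaceI)
  show "of_int n * x \<in> (*) k ` M" if "x \<in> (*) k ` M" for n x
    using that int_mod.subspace_scale[OF assms, of _ n] by (auto simp: mult.left_commute)
qed (use int_mod.subspace_0[OF assms] int_mod.subspace_add[OF assms] in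
    \<open>auto simp: image_iff simp flip: distrib_left\<close>)

lemma scale_ideal_mult_left: "ideal_mult (scale_ideal k I) J = scale_ideal k (ideal_mult I J)"
proof
  show "ideal_mult (scale_ideal k I) J \<subseteq> scale_ideal k (ideal_mult I J)"
    by (subst ideal_mult_subset_iff[OF subspace_scale_ideal[OF subspace_ideal_mult]])
      (auto simp: scale_ideal_def mult.assoc intro!: imageI mult_in_ideal_mult)
  have "ideal_mult I J \<subseteq> {x. k * x \<in> ideal_mult (scale_ideal k I) J}"
    by (subst ideal_mult_subset_iff)
      (auto simp: subspace_vimage_times subspace_ideal_mult scale_ideal_def
        simp flip: mult.assoc intro!: imageI mult_in_ideal_mult)
  then show "scale_ideal k (ideal_mult I J) \<subseteq> ideal_mult (scale_ideal k I) J"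
    by (auto simp: scale_ideal_def)
qed

lemma scale_ideal_mult_right: "ideal_mult I (scale_ideal k J) = scale_ideal k (ideal_mult I J)"
  by (metis scale_ideal_mult_left ideal_mult_commute)

lemma scale_ideal_scale_ideal: "scale_ideal k (scale_ideal l I) = scale_ideal (k * l) I"
  by (simp add: scale_ideal_def image_image mult.assoc)

lemma scale_ideal_one: "scale_ideal 1 I = I"
  by (simp add: scale_ideal_def)


section \<open>Multiplicativity of the ideal norm\<close>

locale field_order =
  fixes R :: "'a::field_char_0 set"
  assumes is_order: "is_order R"
begin

section \<open>Integers and denominators in an order\<close>

lemma one_closed: "1 \<in> R" and mult_closed: "x \<in> R \<Longrightarrow> y \<in> R \<Longrightarrow> x * y \<in> R"
  using is_order unfolding is_order_def
  by (auto dest: subringE(3,6) simp: ring_of_type_algebra_def)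

lemma subspace_order: "int_mod.subspace R"
  using is_order unfolding is_order_def by auto

lemma of_int_closed: "of_int n \<in> R"
  using int_mod.subspace_scale[OF subspace_order one_closed, of n] by simp

text \<open>The elements with a positive integer multiple in \<open>R\<close> form a rational
  subspace containing \<open>R\<close>, and \<open>R\<close> spans the field over the
  rationals.\<close>

lemma exists_int_multiple_in_order:
  obtains n :: int where "n > 0" "of_int n * x \<in> R"
proof -
  let ?S = "{x. \<exists>n::int. n > 0 \<and> of_int n * x \<in> R}"
  have "rat_vs.subspace ?S"
  proof (rule rat_vs.subspaceI)
    show "0 \<in> ?S"
      using int_mod.subspace_0[OF subspace_order] by (auto intro: exI[of _ 1])
  next
    fix x y assume "x \<in> ?S" "y \<in> ?S"
    then obtain m n :: int where mn: "m > 0" "of_int m * x \<in> R" "n > 0" "of_int n * y \<in> R"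
      by blast
    have "of_int n * (of_int m * x) + of_int m * (of_int n * y) \<in> R"
      by (intro int_mod.subspace_add[OF subspace_order] mult_closed[OF of_int_closed] mn)
    then have "of_int (m * n) * (x + y) \<in> R" by (simp add: algebra_simps)
    moreover have "m * n > 0" using mn by simp
    ultimately show "x + y \<in> ?S" by blast
  next
    fix q x assume "x \<in> ?S"
    then obtain m :: int where m: "m > 0" "of_int m * x \<in> R" by blast
    obtain a b where ab: "q = Rat.Fract a b" "b > 0" by (cases q) auto
    have "of_int a * (of_int m * x) \<in> R" using m(2) by (rule mult_closed[OF of_int_closed])
    moreover have "of_int b * of_rat q = (of_int a :: 'a)"
      using ab by (simp add: of_rat_rat)
    moreover have "of_int (b * m) * (of_rat q * x) = (of_int b * of_rat q) * (of_int m * x)"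
      by (simp only: of_int_mult mult_ac)
    ultimately have "of_int (b * m) * (of_rat q * x) \<in> R" by (simp only:)
    moreover have "b * m > 0" using ab m by simp
    ultimately show "of_rat q * x \<in> ?S" by blast
  qed
  moreover have "R \<subseteq> ?S" by (auto intro: exI[of _ 1])
  ultimately have "rat_vs.span R \<subseteq> ?S" by (intro rat_vs.span_minimal)
  then show ?thesis using is_order that unfolding is_order_def by blast
qed

text \<open>This is \<open>fractional_ideal\<close> without the common denominator: the
  \<open>R\<close>-submodules of the field, whose lattice carries the index argument below.
  Negatives come from \<open>-1 \<in> R\<close>.\<close>

definition order_module :: "'a set \<Rightarrow> bool" where
  "order_module M \<longleftrightarrow> 0 \<in> M \<and> (\<forall>x\<in>M. \<forall>y\<in>M. x + y \<in> M) \<and> (\<forall>r\<in>R. \<forall>x\<in>M. r * x \<in> M)"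

lemma fractional_ideal_iff:
  "fractional_ideal R I \<longleftrightarrow> order_module I \<and> (\<exists>d\<in>R. d \<noteq> 0 \<and> (\<forall>x\<in>I. d * x \<in> R))"
  unfolding fractional_ideal_def order_module_def by blast

lemma subspace_order_module: "order_module M \<Longrightarrow> int_mod.subspace M"
  unfolding order_module_def using of_int_closed by (intro int_mod.subspaceI) auto

lemma order_module_order: "order_module R"
  unfolding order_module_def
  using int_mod.subspace_0[OF subspace_order] int_mod.subspace_add[OF subspace_order] mult_closed
  by blast

lemma order_module_Int: "order_module M \<Longrightarrow> order_module N \<Longrightarrow> order_module (M \<inter> N)"
  unfolding order_module_def by blast

lemma order_module_ideal_mult:
  assumes "order_module I"
  shows "order_module (ideal_mult I J)"
  unfolding order_module_def
proof (intro conjI ballI)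
  fix r x assume "r \<in> R" "x \<in> ideal_mult I J"
  have "ideal_mult I J \<subseteq> {x. r * x \<in> ideal_mult I J}"
    using assms \<open>r \<in> R\<close> unfolding order_module_def
    by (subst ideal_mult_subset_iff)
      (auto simp: subspace_vimage_times subspace_ideal_mult simp flip: mult.assoc
        intro!: mult_in_ideal_mult)
  then show "r * x \<in> ideal_mult I J" using \<open>x \<in> ideal_mult I J\<close> by blast
qed (use subspace_ideal_mult[of I J] int_mod.subspace_0 int_mod.subspace_add in blast)+

lemma ideal_mult_order:
  assumes "order_module I"
  shows "ideal_mult I R = I" "ideal_mult R I = I"
proof -
  have "ideal_mult R I \<subseteq> I"
    using assms by (subst ideal_mult_subset_iff) (auto simp: subspace_order_module order_module_def)
  moreover have "I \<subseteq> ideal_mult R I"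
    using mult_in_ideal_mult[OF one_closed] by force
  ultimately show "ideal_mult R I = I" by blast
  then show "ideal_mult I R = I" by (simp add: ideal_mult_commute)
qed

lemma order_module_scale_ideal:
  assumes "order_module M"
  shows "order_module (scale_ideal k M)"
proof -
  have "scale_ideal k M = ideal_mult (scale_ideal k R) M"
    using assms by (simp add: scale_ideal_mult_left ideal_mult_order)
  also have "\<dots> = ideal_mult M (scale_ideal k R)" by (rule ideal_mult_commute)
  finally show ?thesis using order_module_ideal_mult[OF assms] by simp
qed

text \<open>A simple \<open>R\<close>-module is the quotient of \<open>R\<close> by its annihilator.\<close>

lemma subgroup_index_simple_quotient:
  assumes A: "order_module A" and B: "order_module B" and "A \<subset> B"
    and simple: "\<And>M. order_module M \<Longrightarrow> A \<subseteq> M \<Longrightarrow> M \<subseteq> B \<Longrightarrow> M = A \<or> M = B"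
  shows "subgroup_index B A = subgroup_index R {r \<in> R. \<forall>b\<in>B. r * b \<in> A}"
proof -
  obtain x where x: "x \<in> B" "x \<notin> A" using \<open>A \<subset> B\<close> by blast
  let ?ann = "{r \<in> R. \<forall>b\<in>B. r * b \<in> A}"
  \<comment> \<open>This is the module generated by \<open>A\<close> and \<open>x\<close>. As it is
    larger than \<open>A\<close>, simplicity forces it to be \<open>B\<close>, so the quotient is
    cyclic, generated by \<open>x\<close>.\<close>
  define M where "M = {r * x + a | r a. r \<in> R \<and> a \<in> A}"
  note R0 = int_mod.subspace_0[OF subspace_order]
  note Radd = int_mod.subspace_add[OF subspace_order]
  have "order_module M"
    unfolding order_module_def
  proof (intro conjI ballI)
    have "0 = 0 * x + (0 :: 'a)" by simp
    then show "0 \<in> M" using A R0 unfolding M_def order_module_def by blast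
  next
    fix u v assume "u \<in> M" "v \<in> M"
    then obtain r a s b where "u = r * x + a" "v = s * x + b" "r \<in> R" "s \<in> R" "a \<in> A" "b \<in> A"
      unfolding M_def by blast
    moreover from this have "u + v = (r + s) * x + (a + b)" by (simp add: algebra_simps)
    ultimately show "u + v \<in> M" using A Radd unfolding M_def order_module_def by blast
  next
    fix s u assume "s \<in> R" "u \<in> M"
    then obtain r a where "u = r * x + a" "r \<in> R" "a \<in> A" unfolding M_def by blast
    moreover from this have "s * u = (s * r) * x + s * a" by (simp add: algebra_simps)
    ultimately show "s * u \<in> M"
      using A mult_closed \<open>s \<in> R\<close> unfolding M_def order_module_def by blast
  qed
  moreover have "A \<subseteq> M"
  proof
    fix a assume "a \<in> A"
    moreover have "a = 0 * x + a" by simp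
    ultimately show "a \<in> M" using R0 unfolding M_def by blast
  qed
  moreover have "M \<subseteq> B"
    using B x \<open>A \<subset> B\<close> unfolding M_def order_module_def by blast
  moreover have "x \<in> M"
  proof -
    have "x = 1 * x + 0" by simp
    then show ?thesis using one_closed A unfolding M_def order_module_def by blast
  qed
  ultimately have "M = B" using simple x by blast
  \<comment> \<open>\<open>B\<close> is \<open>R x + A\<close> and multiplication is commutative, so
    an element of \<open>R\<close> killing the generator \<open>x\<close> modulo \<open>A\<close>
    kills all of \<open>B\<close>.\<close>
  have ann: "r * x \<in> A \<longleftrightarrow> r \<in> ?ann" if "r \<in> R" for r
  proof
    assume rx: "r * x \<in> A"
    have "r * b \<in> A" if "b \<in> B" for b
    proof -
      obtain s a where "b = s * x + a" "s \<in> R" "a \<in> A"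
        using \<open>b \<in> B\<close> unfolding M_def \<open>M = B\<close>[symmetric] by blast
      moreover from this have "r * b = s * (r * x) + r * a" by (simp add: algebra_simps)
      ultimately show ?thesis using A rx \<open>r \<in> R\<close> unfolding order_module_def by auto
    qed
    then show "r \<in> ?ann" using that by blast
  qed (use x in blast)
  have "order_module ?ann"
    using A R0 Radd mult_closed unfolding order_module_def
    by (auto simp: distrib_right mult.assoc)
  \<comment> \<open>The map sending \<open>r\<close> to \<open>r * x\<close> identifies
    \<open>R / ?ann\<close> with \<open>B / A\<close>.\<close>
  have "subgroup_index R ?ann = subgroup_index B A"
  proof (rule subgroup_index_eq_if_hom[where f = "\<lambda>r. r * x"])
    show "r * x \<in> B" if "r \<in> R" for r
      using that B x unfolding order_module_def by blast
    show "\<exists>r\<in>R. y - r * x \<in> A" if "y \<in> B" for y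
    proof -
      obtain r a where "y = r * x + a" "r \<in> R" "a \<in> A"
        using \<open>y \<in> B\<close> unfolding M_def \<open>M = B\<close>[symmetric] by blast
      then show ?thesis by (intro bexI[of _ r]) simp_all
    qed
  qed (use ann subspace_order subspace_order_module A \<open>order_module ?ann\<close> in
      \<open>simp_all add: left_diff_distrib\<close>)
  then show ?thesis by simp
qed

text \<open>By linearity it suffices to move \<open>r\<close> past a factor from \<open>I\<close>.
  Applied to \<open>I\<close> and then to its inverse, this equates the annihilators of
  \<open>B / A\<close> and \<open>I B / I A\<close>.\<close>

lemma ideal_mult_preserves_annihilation:
  assumes "\<And>b. b \<in> B \<Longrightarrow> r * b \<in> A" "b \<in> ideal_mult I B"
  shows "r * b \<in> ideal_mult I A"
proof -
  have "ideal_mult I B \<subseteq> {x. r * x \<in> ideal_mult I A}"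
    using assms(1) by (subst ideal_mult_subset_iff)
      (auto simp: subspace_vimage_times subspace_ideal_mult mult.left_commute[of r]
        intro!: mult_in_ideal_mult)
  with assms(2) show ?thesis by blast
qed

text \<open>
  Multiplication by \<open>I\<close> is an automorphism of the lattice of modules, so it preserves composition
  series, and it preserves the annihilators of their simple quotients.
\<close>

lemma subgroup_index_ideal_mult:
  assumes I: "order_module I" and J: "order_module J" and IJ: "ideal_mult I J = R"
    and "order_module A" "order_module B" "A \<subseteq> B" "subgroup_index B A \<noteq> 0"
  shows "subgroup_index (ideal_mult I B) (ideal_mult I A) = subgroup_index B A"
  using assms(4-7)
\<comment> \<open>Strong induction on the finite index takes the place of an explicit composition
  series.\<close>
proof (induction "subgroup_index B A" arbitrary: A B rule: less_induct)
  case less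
  note A = less.prems(1) and B = less.prems(2)
  have JI: "ideal_mult J (ideal_mult I M) = M" "ideal_mult I (ideal_mult J M) = M"
    if "order_module M" for M
    using that IJ by (simp_all add: ideal_mult_order ideal_mult_commute[of J I]
        flip: ideal_mult_assoc)
  note sub = subspace_order_module
  show ?case
  proof (cases "A = B")
    case True
    then show ?thesis by (simp add: subgroup_index_self sub B subspace_ideal_mult)
  next
    case False
    then have "A \<subset> B" using less.prems by blast
    show ?thesis
    proof (cases "\<exists>M. order_module M \<and> A \<subset> M \<and> M \<subset> B")
      case True
      then obtain M where M: "order_module M" "A \<subset> M" "M \<subset> B" by blast
      have tower: "subgroup_index B A = subgroup_index B M * subgroup_index M A"
        using M A B by (intro subgroup_index_tower sub) auto
      \<comment> \<open>The inclusions are proper, so neither factor is 1; their product is nonzero,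
        so neither is 0. Both are therefore smaller than the index of \<open>A\<close> in
        \<open>B\<close>, and the induction hypothesis applies to each.\<close>
      have "subgroup_index B M \<noteq> 1" "subgroup_index M A \<noteq> 1"
        using subgroup_index_eq_1_imp_subset[of B M] subgroup_index_eq_1_imp_subset[of M A]
          M A B sub by auto
      then have "subgroup_index B M < subgroup_index B A" "subgroup_index M A < subgroup_index B A"
        "subgroup_index B M \<noteq> 0" "subgroup_index M A \<noteq> 0"
        using tower less.prems(4) by auto
      moreover have "subgroup_index (ideal_mult I B) (ideal_mult I A) =
          subgroup_index (ideal_mult I B) (ideal_mult I M) *
          subgroup_index (ideal_mult I M) (ideal_mult I A)"
        using M by (intro subgroup_index_tower subspace_ideal_mult ideal_mult_mono) auto
      ultimately show ?thesis
        using less.hyps M A B tower by (simp add: psubset_imp_subset)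
    next
      case no_M: False
      have IAB: "ideal_mult I A \<subset> ideal_mult I B"
      proof
        show "ideal_mult I A \<subseteq> ideal_mult I B"
          using \<open>A \<subset> B\<close> by (intro ideal_mult_mono) auto
        show "ideal_mult I A \<noteq> ideal_mult I B"
          using JI A B \<open>A \<noteq> B\<close> by metis
      qed
      have "subgroup_index B A = subgroup_index R {r \<in> R. \<forall>b\<in>B. r * b \<in> A}"
        using no_M A B \<open>A \<subset> B\<close> by (intro subgroup_index_simple_quotient) auto
      also have "{r \<in> R. \<forall>b\<in>B. r * b \<in> A} =
          {r \<in> R. \<forall>b\<in>ideal_mult I B. r * b \<in> ideal_mult I A}"
      proof -
        \<comment> \<open>Multiplication by \<open>J\<close> undoes multiplication by
          \<open>I\<close> on both modules, which gives the reverse inclusion of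
          annihilators.\<close>
        have "r * b \<in> A" if "\<forall>b\<in>ideal_mult I B. r * b \<in> ideal_mult I A" "b \<in> B" for r b
          using ideal_mult_preserves_annihilation[of "ideal_mult I B" r "ideal_mult I A" b J] that
          by (simp add: JI A B)
        then show ?thesis
          using ideal_mult_preserves_annihilation[of B _ A _ I] by blast
      qed
      \<comment> \<open>The quotient of \<open>I B\<close> by \<open>I A\<close> is simple as well:
        a module between them, multiplied by \<open>J\<close>, lies between \<open>A\<close> and
        \<open>B\<close>.\<close>
      also have "subgroup_index R \<dots> = subgroup_index (ideal_mult I B) (ideal_mult I A)"
      proof (rule subgroup_index_simple_quotient[symmetric])
        fix M assume M: "order_module M" "ideal_mult I A \<subseteq> M" "M \<subseteq> ideal_mult I B"
        have "A \<subseteq> ideal_mult J M" "ideal_mult J M \<subseteq> B"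
          using ideal_mult_mono[OF subset_refl M(2), of J] ideal_mult_mono[OF subset_refl M(3), of J]
          by (simp_all add: JI A B)
        then have "ideal_mult J M = A \<or> ideal_mult J M = B"
          using no_M order_module_ideal_mult[OF J] by blast
        then show "M = ideal_mult I A \<or> M = ideal_mult I B"
          using JI(2)[OF M(1)] by metis
      qed (simp_all add: order_module_ideal_mult I IAB)
      finally show ?thesis by simp
    qed
  qed
qed

text \<open>Both ideals lie between \<open>n d^-1 R\<close> and \<open>d^-1 R\<close>, where
  \<open>d\<close> is a denominator of \<open>B\<close> and \<open>n\<close> a positive integer. The
  index of these two lattices is that of \<open>n R\<close> in \<open>R\<close>, which is finite,
  and the tower formula passes finiteness on.\<close>

lemma subgroup_index_nonzero:
  assumes A: "fractional_ideal R A" and B: "fractional_ideal R B" and "A \<subseteq> B" "A \<noteq> {0}"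
  shows "subgroup_index B A \<noteq> 0"
proof -
  have mA: "order_module A" and mB: "order_module B"
    using A B by (auto simp: fractional_ideal_iff)
  obtain a where a: "a \<in> A" "a \<noteq> 0" using mA \<open>A \<noteq> {0}\<close> unfolding order_module_def by blast
  obtain d where d: "d \<in> R" "d \<noteq> 0" "\<And>x. x \<in> B \<Longrightarrow> d * x \<in> R"
    using B by (auto simp: fractional_ideal_iff)
  \<comment> \<open>Then \<open>n d^-1\<close> equals \<open>n (d a)^-1\<close> times
    \<open>a\<close>, so it lies in \<open>A\<close>, and with it \<open>?N\<close>.\<close>
  obtain n :: int where n: "n > 0" "of_int n * (inverse (d * a)) \<in> R"
    by (rule exists_int_multiple_in_order)
  let ?L = "scale_ideal (inverse d) R"
  let ?N = "scale_ideal (inverse d) (scale_ideal (of_int n) R)"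
  note subs = subspace_scale_ideal subspace_order subspace_order_module mA mB
  have BL: "B \<subseteq> ?L"
  proof
    fix x assume "x \<in> B"
    then have "d * x \<in> R" "x = inverse d * (d * x)" using d by auto
    then show "x \<in> ?L" unfolding scale_ideal_def by blast
  qed
  have NA: "?N \<subseteq> A"
  proof
    fix x assume "x \<in> ?N"
    then obtain r where r: "r \<in> R" "x = inverse d * (of_int n * r)"
      by (auto simp: scale_ideal_def)
    then have "x = (r * (of_int n * inverse (d * a))) * a" using a d by (simp add: field_simps)
    moreover have "r * (of_int n * inverse (d * a)) \<in> R"
      using r(1) n(2) by (rule mult_closed)
    ultimately show "x \<in> A"
      using a(1) mA unfolding order_module_def by blast
  qed
  obtain S where S: "finite S" "R = int_mod.span S"
    using is_order unfolding is_order_def by blast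
  have "subgroup_index R (scale_ideal (of_int n) R) \<noteq> 0"
    unfolding S(2) by (rule subgroup_index_scale_int_nonzero) (fact S(1) n(1))+
  moreover have "subgroup_index R (scale_ideal (of_int n) R) = subgroup_index ?L ?N"
  proof (rule subgroup_index_eq_if_hom[where f = "\<lambda>x. inverse d * x"])
    show "\<exists>x\<in>R. y - inverse d * x \<in> ?N" if "y \<in> ?L" for y
    proof -
      obtain x where "x \<in> R" "y = inverse d * x"
        using \<open>y \<in> ?L\<close> unfolding scale_ideal_def by blast
      moreover have "0 \<in> ?N" by (rule int_mod.subspace_0) (intro subs)
      ultimately show ?thesis by (intro bexI[of _ x]) simp_all
    qed
    show "inverse d * x \<in> ?N \<longleftrightarrow> x \<in> scale_ideal (of_int n) R" for x
      using d(2) by (simp add: scale_ideal_def inj_image_mem_iff inj_on_def)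
    show "inverse d * x \<in> ?L" if "x \<in> R" for x
      using that unfolding scale_ideal_def by (rule imageI)
  qed (simp_all add: subs right_diff_distrib)
  moreover have "subgroup_index ?L ?N = subgroup_index ?L B * subgroup_index B ?N"
    using BL NA \<open>A \<subseteq> B\<close> by (intro subgroup_index_tower) (auto simp: subs)
  moreover have "subgroup_index B ?N = subgroup_index B A * subgroup_index A ?N"
    using NA \<open>A \<subseteq> B\<close> by (intro subgroup_index_tower) (auto simp: subs)
  ultimately show ?thesis by auto
qed

section \<open>Closure properties of fractional and invertible ideals\<close>

lemma fractional_ideal_order: "fractional_ideal R R"
  using order_module_order one_closed by (auto simp: fractional_ideal_iff intro!: bexI[of _ 1])

lemma fractional_ideal_Int:
  assumes "fractional_ideal R I" "order_module J"
  shows "fractional_ideal R (J \<inter> I)"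
  using assms order_module_Int by (auto simp: fractional_ideal_iff)

lemma fractional_ideal_ideal_mult:
  assumes "fractional_ideal R I" "fractional_ideal R J"
  shows "fractional_ideal R (ideal_mult I J)"
proof -
  obtain d e where d: "d \<in> R" "d \<noteq> 0" "\<And>x. x \<in> I \<Longrightarrow> d * x \<in> R"
    and e: "e \<in> R" "e \<noteq> 0" "\<And>x. x \<in> J \<Longrightarrow> e * x \<in> R"
    using assms unfolding fractional_ideal_iff by metis
  have "(d * e) * (x * y) \<in> R" if "x \<in> I" "y \<in> J" for x y
    using mult_closed[OF d(3)[OF that(1)] e(3)[OF that(2)]] by (simp add: algebra_simps)
  then have "ideal_mult I J \<subseteq> {x. (d * e) * x \<in> R}"
    by (subst ideal_mult_subset_iff) (auto simp: subspace_vimage_times subspace_order)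
  then show ?thesis
    using assms d e mult_closed order_module_ideal_mult
    unfolding fractional_ideal_iff by (intro conjI bexI[of _ "d * e"]) auto
qed

lemma fractional_ideal_scale_ideal:
  assumes "fractional_ideal R I"
  shows "fractional_ideal R (scale_ideal k I)"
proof -
  obtain d where d: "d \<in> R" "d \<noteq> 0" "\<And>x. x \<in> I \<Longrightarrow> d * x \<in> R"
    using assms unfolding fractional_ideal_iff by metis
  \<comment> \<open>The scalar \<open>k\<close> may lie outside \<open>R\<close>; clearing its
    denominator makes \<open>n d\<close> a denominator of the scaled ideal.\<close>
  obtain n :: int where n: "n > 0" "of_int n * k \<in> R"
    by (rule exists_int_multiple_in_order)
  have "(of_int n * d) * (k * x) \<in> R" if "x \<in> I" for x
    using mult_closed[OF n(2) d(3)[OF that]] by (simp add: algebra_simps)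
  moreover have "of_int n * d \<in> R" "of_int n * d \<noteq> 0"
    using n d mult_closed of_int_closed by auto
  ultimately have "\<exists>e\<in>R. e \<noteq> 0 \<and> (\<forall>x\<in>scale_ideal k I. e * x \<in> R)"
    unfolding scale_ideal_def by blast
  then show ?thesis
    using assms order_module_scale_ideal unfolding fractional_ideal_iff by blast
qed

lemma order_module_nonzeroE:
  assumes "order_module M" "M \<noteq> {0}"
  obtains x where "x \<in> M" "x \<noteq> 0"
  using assms unfolding order_module_def by auto

text \<open>A denominator of \<open>I\<close> sends a nonzero element of \<open>I\<close> into
  \<open>R\<close> without leaving \<open>I\<close>. This makes the intersections in
  \<open>ideal_norm\<close> large enough to have finite index.\<close>

lemma fractional_ideal_Int_nonzero:
  assumes I: "fractional_ideal R I" and "I \<noteq> {0}"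
  shows "R \<inter> I \<noteq> {0}"
proof -
  have modu: "order_module I" using I by (simp add: fractional_ideal_iff)
  obtain x where x: "x \<in> I" "x \<noteq> 0"
    using modu \<open>I \<noteq> {0}\<close> by (rule order_module_nonzeroE)
  obtain d where d: "d \<in> R" "d \<noteq> 0" "d * x \<in> R"
    using I x(1) unfolding fractional_ideal_iff by auto
  have "d * x \<in> I" using modu d(1) x(1) unfolding order_module_def by simp
  with d have "d * x \<in> R \<inter> I" by simp
  moreover have "d * x \<noteq> 0" using d(2) x(2) by simp
  ultimately show ?thesis by blast
qed

lemma ideal_mult_nonzero:
  assumes "order_module I" "order_module J" "I \<noteq> {0}" "J \<noteq> {0}"
  shows "ideal_mult I J \<noteq> {0}"
proof -
  obtain x where "x \<in> I" "x \<noteq> 0" using assms(1,3) by (rule order_module_nonzeroE)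
  moreover obtain y where "y \<in> J" "y \<noteq> 0" using assms(2,4) by (rule order_module_nonzeroE)
  ultimately have "x * y \<in> ideal_mult I J" "x * y \<noteq> 0"
    by (simp_all add: mult_in_ideal_mult)
  then show ?thesis by (metis singletonD)
qed

lemma invertible_idealE:
  assumes "invertible_ideal R I"
  obtains J where "fractional_ideal R I" "order_module I" "I \<noteq> {0}"
    "fractional_ideal R J" "order_module J" "ideal_mult I J = R"
proof -
  obtain J where J: "fractional_ideal R I" "fractional_ideal R J" "ideal_mult I J = R"
    using assms unfolding invertible_ideal_def by blast
  have "I \<noteq> {0}"
  proof
    assume "I = {0}"
    \<comment> \<open>The product of the zero ideal with \<open>J\<close> is zero, but it equals
      \<open>R\<close>, which contains 1.\<close>
    then have "R \<subseteq> {0}"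
      using J(3) ideal_mult_subset_iff[of "{0}" I J] by (simp add: int_mod.subspace_def)
    then show False using one_closed by auto
  qed
  moreover have "order_module I" "order_module J" using J fractional_ideal_iff by blast+
  ultimately show ?thesis using J that by blast
qed

lemma order_module_if_invertible: "invertible_ideal R I \<Longrightarrow> order_module I"
  by (erule invertible_idealE)

lemma invertible_ideal_order: "invertible_ideal R R"
  unfolding invertible_ideal_def
  using fractional_ideal_order ideal_mult_order order_module_order by blast

lemma invertible_ideal_ideal_mult:
  assumes "invertible_ideal R I" "invertible_ideal R J"
  shows "invertible_ideal R (ideal_mult I J)"
proof -
  obtain I' J' where I: "fractional_ideal R I" "fractional_ideal R I'" "ideal_mult I I' = R"
    and J: "fractional_ideal R J" "fractional_ideal R J'" "ideal_mult J J' = R" "order_module I"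
    using assms by (metis invertible_idealE)
  have "ideal_mult (ideal_mult I J) (ideal_mult J' I') = ideal_mult (ideal_mult I (ideal_mult J J')) I'"
    by (simp add: ideal_mult_assoc)
  also have "\<dots> = R" using I J by (simp add: ideal_mult_order)
  finally show ?thesis
    using I J fractional_ideal_ideal_mult unfolding invertible_ideal_def by blast
qed

lemma invertible_ideal_scale_ideal:
  assumes "invertible_ideal R I" "k \<noteq> 0"
  shows "invertible_ideal R (scale_ideal k I)"
proof -
  obtain J where J: "fractional_ideal R I" "fractional_ideal R J" "ideal_mult I J = R"
    using assms(1) by (rule invertible_idealE)
  have "ideal_mult (scale_ideal k I) (scale_ideal (inverse k) J) = R"
    using J \<open>k \<noteq> 0\<close> by (simp add: scale_ideal_mult_left scale_ideal_mult_right
        scale_ideal_scale_ideal scale_ideal_one)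
  then show ?thesis
    using J fractional_ideal_scale_ideal unfolding invertible_ideal_def by blast
qed

text \<open>Replacing \<open>R \<inter> I\<close> by the smaller \<open>C\<close> multiplies
  numerator and denominator by the index of \<open>C\<close> in \<open>R \<inter> I\<close>, which
  is nonzero and cancels.\<close>

lemma ideal_norm_eq:
  assumes "order_module I" "order_module C" "C \<subseteq> R \<inter> I" "subgroup_index R C \<noteq> 0"
  shows "ideal_norm R I = of_nat (subgroup_index R C) / of_nat (subgroup_index I C)"
proof -
  have "subgroup_index R C = subgroup_index R (R \<inter> I) * subgroup_index (R \<inter> I) C"
    "subgroup_index I C = subgroup_index I (R \<inter> I) * subgroup_index (R \<inter> I) C"
    using assms order_module_Int order_module_order
    by (auto intro!: subgroup_index_tower subspace_order_module)
  then show ?thesis using assms(4) by (simp add: ideal_norm_def)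
qed

text \<open>Multiplying by \<open>I\<close> preserves indices, so \<open>[I : I C] = [R : C]\<close>
  and \<open>[I J : I C] = [J : C]\<close> for \<open>C = R \<inter> J\<close>. Measuring
  \<open>I\<close> and \<open>I J\<close> against a common \<open>E\<close> inside
  \<open>I C\<close>, the factors \<open>[R : C]\<close> and \<open>[I C : E]\<close> account for
  the quotient of the two norms.\<close>

lemma ideal_norm_mult:
  assumes "invertible_ideal R I" "invertible_ideal R J"
  shows "ideal_norm R (ideal_mult I J) = ideal_norm R I * ideal_norm R J"
proof -
  obtain I' where I: "fractional_ideal R I" "order_module I" "I \<noteq> {0}"
    and I': "order_module I'" "ideal_mult I I' = R"
    using assms(1) by (rule invertible_idealE)
  obtain J' where J: "fractional_ideal R J" "order_module J" "J \<noteq> {0}"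
    using assms(2) by (rule invertible_idealE)
  define C where "C = R \<inter> J"
  have C: "fractional_ideal R C" "order_module C" "C \<noteq> {0}"
    unfolding C_def using J fractional_ideal_Int order_module_order fractional_ideal_Int_nonzero
    by (auto simp: fractional_ideal_iff)
  note frac = fractional_ideal_ideal_mult I(1) J(1) C(1) fractional_ideal_order
  note modu = order_module_ideal_mult I(2) J(2) C(2) order_module_order
  have IC: "ideal_mult I C \<noteq> {0}" using I C by (intro ideal_mult_nonzero)
  \<comment> \<open>As \<open>I C\<close> lies in both \<open>I\<close> and \<open>I J\<close>, the
    single module \<open>E\<close> computes both norms through \<open>ideal_norm_eq\<close>.\<close>
  define E where "E = R \<inter> ideal_mult I C"
  have E: "fractional_ideal R E" "order_module E" "E \<noteq> {0}"
    unfolding E_def using IC fractional_ideal_Int fractional_ideal_Int_nonzero frac modu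
    by (auto simp: fractional_ideal_iff)
  have sub: "ideal_mult I C \<subseteq> I" "ideal_mult I C \<subseteq> ideal_mult I J"
    using ideal_mult_mono[of I I C R] ideal_mult_mono[of I I C J] ideal_mult_order(1)[OF I(2)]
    by (auto simp: C_def)
  have nz: "subgroup_index R E \<noteq> 0" "subgroup_index (ideal_mult I C) E \<noteq> 0"
    "subgroup_index R C \<noteq> 0" "subgroup_index J C \<noteq> 0"
    by (rule subgroup_index_nonzero; use E C frac in \<open>auto simp: E_def C_def\<close>)+
  have "subgroup_index I E = subgroup_index I (ideal_mult I C) * subgroup_index (ideal_mult I C) E"
    using sub by (intro subgroup_index_tower subspace_order_module)
      (auto simp: modu E[unfolded E_def] E_def)
  moreover have "subgroup_index I (ideal_mult I C) = subgroup_index R C"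
    using subgroup_index_ideal_mult[OF I(2) I' C(2) order_module_order _ nz(3)]
    by (simp add: ideal_mult_order I C_def)
  moreover have "subgroup_index (ideal_mult I J) E =
      subgroup_index (ideal_mult I J) (ideal_mult I C) * subgroup_index (ideal_mult I C) E"
    using sub by (intro subgroup_index_tower subspace_order_module)
      (auto simp: modu E[unfolded E_def] E_def)
  moreover have "subgroup_index (ideal_mult I J) (ideal_mult I C) = subgroup_index J C"
    using subgroup_index_ideal_mult[OF I(2) I' C(2) J(2) _ nz(4)] by (simp add: C_def)
  moreover have "ideal_norm R I = of_nat (subgroup_index R E) / of_nat (subgroup_index I E)"
    using sub nz by (intro ideal_norm_eq) (auto simp: I E[unfolded E_def] E_def)
  moreover have "ideal_norm R (ideal_mult I J) =
      of_nat (subgroup_index R E) / of_nat (subgroup_index (ideal_mult I J) E)"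
    using sub nz by (intro ideal_norm_eq) (auto simp: modu E[unfolded E_def] E_def)
  moreover have "ideal_norm R J = of_nat (subgroup_index R C) / of_nat (subgroup_index J C)"
    by (simp add: ideal_norm_def C_def)
  ultimately show ?thesis using nz by simp
qed

lemma ideal_norm_order: "ideal_norm R R = 1"
  by (simp add: ideal_norm_def subgroup_index_self subspace_order)

end


section \<open>The group of projective triples\<close>

locale cubic_order = field_order +
  assumes dim_eq_3: "rat_vs.dim (UNIV :: 'a::field_char_0 set) = 3"
begin

lemma projective_triples_order: "(R, 1) \<in> projective_triples R"
  by (simp add: projective_triples_def invertible_ideal_order ideal_mult_order order_module_order
      scale_ideal_one cubic_norm_mult_one[OF dim_eq_3] ideal_norm_order)

lemma projective_triples_mult:
  assumes "(I, d) \<in> projective_triples R" "(I', d') \<in> projective_triples R"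
  shows "(ideal_mult I I', d * d') \<in> projective_triples R"
proof -
  have "ideal_mult (ideal_mult I I') (ideal_mult I I') =
      ideal_mult (ideal_mult I I) (ideal_mult I' I')"
    by (metis ideal_mult_assoc ideal_mult_commute)
  also have "\<dots> = scale_ideal (d * d') R"
    using assms by (simp add: projective_triples_def scale_ideal_mult_left scale_ideal_mult_right
        scale_ideal_scale_ideal ideal_mult_order order_module_order mult.commute)
  finally show ?thesis
    using assms by (simp add: projective_triples_def invertible_ideal_ideal_mult ideal_norm_mult
        cubic_norm_mult_one[OF dim_eq_3] power_mult_distrib)
qed

text \<open>From \<open>I I = R\<close>, multiplicativity gives that the square of the norm of
  \<open>I\<close> is 1, which is the norm of the element 1; so the norm condition holds
  automatically.\<close>

lemma I2_group_iff_projective_triples: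
  "I \<in> carrier (I2_group R) \<longleftrightarrow> (I, 1) \<in> projective_triples R"
proof -
  have "(ideal_norm R I)\<^sup>2 = 1" if "invertible_ideal R I" "ideal_mult I I = R"
    using ideal_norm_mult[OF that(1,1)] that(2) by (simp add: power2_eq_square ideal_norm_order)
  then show ?thesis
    by (auto simp: I2_group_def projective_triples_def scale_ideal_one
        cubic_norm_mult_one[OF dim_eq_3])
qed

lemma group_I2_group: "group (I2_group R)"
proof (rule groupI)
  fix I J assume "I \<in> carrier (I2_group R)" "J \<in> carrier (I2_group R)"
  then show "I \<otimes>\<^bsub>I2_group R\<^esub> J \<in> carrier (I2_group R)"
    using projective_triples_mult[of I 1 J 1]
    by (simp add: I2_group_iff_projective_triples) (simp add: I2_group_def)
next
  show "\<one>\<^bsub>I2_group R\<^esub> \<in> carrier (I2_group R)"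
    by (simp add: I2_group_iff_projective_triples) (simp add: I2_group_def projective_triples_order)
next
  fix I assume I: "I \<in> carrier (I2_group R)"
  then have "order_module I"
    unfolding I2_group_def using order_module_if_invertible by simp
  then show "\<one>\<^bsub>I2_group R\<^esub> \<otimes>\<^bsub>I2_group R\<^esub> I = I"
    by (simp add: I2_group_def ideal_mult_order)
  show "\<exists>J\<in>carrier (I2_group R). J \<otimes>\<^bsub>I2_group R\<^esub> I = \<one>\<^bsub>I2_group R\<^esub>"
    \<comment> \<open>Every element is its own inverse, by the condition \<open>I I = R\<close> in
      the carrier.\<close>
    using I by (intro bexI[of _ I]) (simp_all add: I2_group_def)
qed (simp add: I2_group_def ideal_mult_assoc)

section \<open>Equivalence of triples and composition of classes\<close>

lemma equiv_triple_rel: "equiv (projective_triples R) (triple_rel R)"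
proof (rule equivI)
  show "refl_on (projective_triples R) (triple_rel R)"
    by (rule refl_onI) (auto simp: triple_rel_def scale_ideal_one intro!: exI[of _ 1])
  show "sym (triple_rel R)"
  proof (rule symI)
    fix s t assume "(s, t) \<in> triple_rel R"
    then obtain I d k where k: "k \<noteq> 0" "s = (I, d)" "t = (scale_ideal k I, k\<^sup>2 * d)"
      "s \<in> projective_triples R" "t \<in> projective_triples R"
      by (auto simp: triple_rel_def)
    have "I = scale_ideal (inverse k) (scale_ideal k I)" "d = (inverse k)\<^sup>2 * (k\<^sup>2 * d)"
      using k(1) by (simp_all add: scale_ideal_scale_ideal scale_ideal_one field_simps)
    then have "\<exists>l. l \<noteq> 0 \<and> I = scale_ideal l (scale_ideal k I) \<and> d = l\<^sup>2 * (k\<^sup>2 * d)"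
      using k(1) by (intro exI[of _ "inverse k"]) simp
    then show "(t, s) \<in> triple_rel R"
      using k by (simp add: triple_rel_def)
  qed
  show "trans (triple_rel R)"
  proof (rule transI)
    fix s t u assume "(s, t) \<in> triple_rel R" "(t, u) \<in> triple_rel R"
    then obtain I d k l where k: "k \<noteq> 0" "s = (I, d)" "s \<in> projective_triples R"
      "l \<noteq> 0" "u = (scale_ideal l (scale_ideal k I), l\<^sup>2 * (k\<^sup>2 * d))" "u \<in> projective_triples R"
      by (auto simp: triple_rel_def)
    have "u = (scale_ideal (l * k) I, (l * k)\<^sup>2 * d)"
      using k by (simp add: scale_ideal_scale_ideal power_mult_distrib mult.assoc)
    moreover have "l * k \<noteq> 0" using k by simp
    ultimately show "(s, u) \<in> triple_rel R"
      using k unfolding triple_rel_def by blast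
  qed
qed (auto simp: triple_rel_def)

lemma triple_class_eq_iff:
  assumes "s \<in> projective_triples R" "t \<in> projective_triples R"
  shows "triple_class R s = triple_class R t \<longleftrightarrow> (s, t) \<in> triple_rel R"
  unfolding triple_class_def using eq_equiv_class_iff[OF equiv_triple_rel assms] .

lemma triple_mult_closed:
  assumes "s \<in> projective_triples R" "t \<in> projective_triples R"
  shows "triple_mult s t \<in> projective_triples R"
  using assms projective_triples_mult by (cases s; cases t) (simp add: triple_mult_def)

text \<open>Scaling the factors by \<open>k\<close> and \<open>l\<close> scales the product by
  \<open>k * l\<close>; hence composition is well defined on classes.\<close>

lemma triple_mult_cong:
  assumes "(s, s') \<in> triple_rel R" "(t, t') \<in> triple_rel R"
  shows "(triple_mult s t, triple_mult s' t') \<in> triple_rel R"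
proof -
  obtain I d k where k: "k \<noteq> 0" "s = (I, d)" "s' = (scale_ideal k I, k\<^sup>2 * d)"
      "s \<in> projective_triples R" "s' \<in> projective_triples R"
    using assms(1) by (auto simp: triple_rel_def)
  obtain J e l where l: "l \<noteq> 0" "t = (J, e)" "t' = (scale_ideal l J, l\<^sup>2 * e)"
      "t \<in> projective_triples R" "t' \<in> projective_triples R"
    using assms(2) by (auto simp: triple_rel_def)
  have "triple_mult s' t' = (scale_ideal (k * l) (ideal_mult I J), (k * l)\<^sup>2 * (d * e))"
    using k l by (simp add: triple_mult_def scale_ideal_mult_left scale_ideal_mult_right
        scale_ideal_scale_ideal power_mult_distrib mult_ac)
  moreover have "triple_mult s t = (ideal_mult I J, d * e)"
    using k l by (simp add: triple_mult_def)
  moreover have "k * l \<noteq> 0" using k l by simp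
  moreover have "triple_mult s t \<in> projective_triples R" "triple_mult s' t' \<in> projective_triples R"
    using k l triple_mult_closed by blast+
  ultimately show ?thesis
    unfolding triple_rel_def by (auto intro!: exI[of _ "k * l"])
qed

text \<open>The union over representatives in \<open>H_group\<close> collapses to one class, because
  all products of representatives are equivalent.\<close>

lemma H_group_mult:
  assumes "s \<in> projective_triples R" "t \<in> projective_triples R"
  shows "triple_class R s \<otimes>\<^bsub>H_group R\<^esub> triple_class R t = triple_class R (triple_mult s t)"
proof -
  have "congruent2 (triple_rel R) (triple_rel R) (\<lambda>s t. triple_class R (triple_mult s t))"
  proof (rule congruent2I')
    fix s s' t t' assume "(s, s') \<in> triple_rel R" "(t, t') \<in> triple_rel R"
    then have "(triple_mult s t, triple_mult s' t') \<in> triple_rel R" by (rule triple_mult_cong)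
    then show "triple_class R (triple_mult s t) = triple_class R (triple_mult s' t')"
      unfolding triple_class_def by (rule equiv_class_eq[OF equiv_triple_rel])
  qed
  from UN_equiv_class2[OF equiv_triple_rel equiv_triple_rel this assms] show ?thesis
    by (simp add: H_group_def triple_class_def)
qed

lemma carrier_H_group: "carrier (H_group R) = triple_class R ` projective_triples R"
  by (auto simp: H_group_def triple_class_def quotient_def)

lemma group_H_group: "group (H_group R)"
proof (rule groupI)
  have one: "\<one>\<^bsub>H_group R\<^esub> = triple_class R (R, 1)" by (simp add: H_group_def)
  show "\<one>\<^bsub>H_group R\<^esub> \<in> carrier (H_group R)"
    using projective_triples_order by (simp add: one carrier_H_group)
  fix C assume "C \<in> carrier (H_group R)"
  then obtain I d where C: "C = triple_class R (I, d)" and t: "(I, d) \<in> projective_triples R"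
    by (auto simp: carrier_H_group)
  have "order_module I" using t by (simp add: projective_triples_def order_module_if_invertible)
  then show "\<one>\<^bsub>H_group R\<^esub> \<otimes>\<^bsub>H_group R\<^esub> C = C"
    by (simp add: one C H_group_mult[OF projective_triples_order t] triple_mult_def
        ideal_mult_order)
  \<comment> \<open>The square of the triple is \<open>(d R, d^2)\<close>, the scaling of
    \<open>(R, 1)\<close> by \<open>d\<close>; so each class is its own inverse.\<close>
  have "((R, 1), triple_mult (I, d) (I, d)) \<in> triple_rel R"
    using t triple_mult_closed[OF t t] projective_triples_order
    by (auto simp: triple_rel_def triple_mult_def projective_triples_def power2_eq_square)
  then have "triple_class R (R, 1) = triple_class R (triple_mult (I, d) (I, d))"
    using triple_class_eq_iff[OF projective_triples_order triple_mult_closed[OF t t]] by simp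
  then have "C \<otimes>\<^bsub>H_group R\<^esub> C = \<one>\<^bsub>H_group R\<^esub>"
    by (simp add: C one H_group_mult[OF t t])
  then show "\<exists>D\<in>carrier (H_group R). D \<otimes>\<^bsub>H_group R\<^esub> C = \<one>\<^bsub>H_group R\<^esub>"
    using t C by (auto simp: carrier_H_group)
next
  fix C D assume "C \<in> carrier (H_group R)" "D \<in> carrier (H_group R)"
  then show "C \<otimes>\<^bsub>H_group R\<^esub> D \<in> carrier (H_group R)"
    using triple_mult_closed by (auto simp: carrier_H_group H_group_mult)
next
  fix C D E
  assume "C \<in> carrier (H_group R)" "D \<in> carrier (H_group R)" "E \<in> carrier (H_group R)"
  then obtain s t u where "C = triple_class R s" "D = triple_class R t" "E = triple_class R u"
    and T: "s \<in> projective_triples R" "t \<in> projective_triples R" "u \<in> projective_triples R"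
    unfolding carrier_H_group by blast
  moreover have "triple_mult (triple_mult s t) u = triple_mult s (triple_mult t u)"
    by (cases s; cases t; cases u) (simp add: triple_mult_def ideal_mult_assoc mult.assoc)
  ultimately show "C \<otimes>\<^bsub>H_group R\<^esub> D \<otimes>\<^bsub>H_group R\<^esub> E =
      C \<otimes>\<^bsub>H_group R\<^esub> (D \<otimes>\<^bsub>H_group R\<^esub> E)"
    by (simp add: H_group_mult triple_mult_closed)
qed

section \<open>The homomorphism \<open>I2_to_H\<close> and its image\<close>

lemma I2_to_H_hom: "I2_to_H R \<in> hom (I2_group R) (H_group R)"
proof (rule homI)
  fix I assume "I \<in> carrier (I2_group R)"
  then show "I2_to_H R I \<in> carrier (H_group R)"
    by (simp add: I2_group_iff_projective_triples carrier_H_group I2_to_H_def)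
next
  fix I J assume "I \<in> carrier (I2_group R)" "J \<in> carrier (I2_group R)"
  then show "I2_to_H R (I \<otimes>\<^bsub>I2_group R\<^esub> J) =
      I2_to_H R I \<otimes>\<^bsub>H_group R\<^esub> I2_to_H R J"
    by (simp add: I2_group_iff_projective_triples I2_to_H_def H_group_mult)
      (simp add: I2_group_def triple_mult_def)
qed

lemma inj_on_I2_to_H: "inj_on (I2_to_H R) (carrier (I2_group R))"
proof (rule inj_onI)
  fix I J assume I: "I \<in> carrier (I2_group R)" and "J \<in> carrier (I2_group R)"
    and "I2_to_H R I = I2_to_H R J"
  then have "((I, 1), (J, 1)) \<in> triple_rel R"
    by (simp add: I2_group_iff_projective_triples I2_to_H_def triple_class_eq_iff)
  \<comment> \<open>Both second components are 1, so the scalar is a square root of 1 in a field,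
    that is 1 or -1; an additive group is stable under either.\<close>
  then obtain k where "J = scale_ideal k I" "k\<^sup>2 = 1"
    by (auto simp: triple_rel_def)
  then have "J = scale_ideal 1 I \<or> J = scale_ideal (- 1) I" by (auto simp: power2_eq_1_iff)
  moreover have "scale_ideal (- 1) I = I"
  proof -
    have "int_mod.subspace I"
      using I unfolding I2_group_def
      using order_module_if_invertible subspace_order_module by simp
    then have "- x \<in> I" if "x \<in> I" for x using that by (rule int_mod.subspace_neg)
    then show ?thesis by (force simp: scale_ideal_def image_iff)
  qed
  ultimately show "I = J" by (auto simp: scale_ideal_one)
qed

lemma I2_to_H_image: "I2_to_H R ` carrier (I2_group R) = H_red R"
proof (intro equalityI subsetI)
  fix C assume "C \<in> I2_to_H R ` carrier (I2_group R)"
  then obtain I where "(I, 1) \<in> projective_triples R" "C = triple_class R (I, 1)"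
    by (auto simp: I2_group_iff_projective_triples I2_to_H_def)
  then show "C \<in> H_red R"
    unfolding H_red_def
    by (intro CollectI exI[of _ I] exI[of _ 1] conjI) simp_all
next
  fix C assume "C \<in> H_red R"
  then obtain I k where C: "C = triple_class R (I, k\<^sup>2)" and k: "k \<noteq> 0"
    and t: "(I, k\<^sup>2) \<in> projective_triples R"
    unfolding H_red_def by blast
  \<comment> \<open>Scaling by \<open>k^-1\<close> turns the second component \<open>k^2\<close>
    into 1 within the same class.\<close>
  define J where "J = scale_ideal (inverse k) I"
  \<comment> \<open>This is the scalar left in \<open>J J\<close> once \<open>I I\<close> has been
    replaced by \<open>k^2 R\<close>; it shows \<open>J J = R\<close>.\<close>
  have "inverse k * (inverse k * (k * k)) = 1" using k by (simp add: field_simps)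
  then have "J \<in> carrier (I2_group R)"
    using t k by (simp add: J_def I2_group_def projective_triples_def scale_ideal_mult_left
        scale_ideal_mult_right scale_ideal_scale_ideal invertible_ideal_scale_ideal
        power2_eq_square scale_ideal_one)
  moreover have "I2_to_H R J = C"
  proof -
    have J: "(J, 1) \<in> projective_triples R"
      using \<open>J \<in> carrier (I2_group R)\<close> by (simp add: I2_group_iff_projective_triples)
    have "I = scale_ideal k J"
      using k by (simp add: J_def scale_ideal_scale_ideal scale_ideal_one)
    then have "((J, 1), (I, k\<^sup>2)) \<in> triple_rel R"
      using J t k by (auto simp: triple_rel_def)
    then show ?thesis
      by (simp add: C I2_to_H_def triple_class_eq_iff J t)
  qed
  ultimately show "C \<in> I2_to_H R ` carrier (I2_group R)" by blast
qed

end

theorem theorem16: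
  fixes R :: "'a::field_char_0 set"
  assumes "S3_cubic_field TYPE('a)"
    and "is_order R"
  shows "group_hom (I2_group R) (H_group R) (I2_to_H R) \<and>
         inj_on (I2_to_H R) (carrier (I2_group R)) \<and>
         I2_to_H R ` carrier (I2_group R) = H_red R \<and>
         I2_group R \<cong> (H_group R)\<lparr>carrier := H_red R\<rparr>"
proof -
  interpret cubic_order R
    using assms by unfold_locales (simp_all add: S3_cubic_field_def)
  have "group_hom (I2_group R) (H_group R) (I2_to_H R)"
    by (simp add: group_hom_def group_hom_axioms_def group_I2_group group_H_group I2_to_H_hom)
  moreover have "I2_to_H R \<in> iso (I2_group R) ((H_group R)\<lparr>carrier := H_red R\<rparr>)"
    using I2_to_H_hom inj_on_I2_to_H I2_to_H_image
    by (auto simp: iso_def hom_def bij_betw_def)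
  ultimately show ?thesis
    using inj_on_I2_to_H I2_to_H_image by (auto intro: is_isoI)
qed

end
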